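(* Let $T$ be a rooted tree. An ideal of the commutative BCK-algebra $\mathbf{A}^T$ is prime if and only if it equals $I(p)=\{\mathbf{u}\in A^T\mid\mathbf{u}_p=\mathbf{0}_p\}$ for some root-based path $p$ in $T$.
   Context: A commutative BCK-algebra is an algebra $\mathbf{A}=\langle A;\cdot,0\rangle$ of type $(2,0)$ such that for all $x,y,z\in A$: $(x\cdot y)\cdot z=(x\cdot z)\cdot y$; $x\cdot(x\cdot y)=y\cdot(y\cdot x)$; $x\cdot x=0$; $x\cdot 0=x$. Put $x\wedge y:=y\cdot(y\cdot x)$. An ideal is a subset $I\subseteq A$ with $0\in I$ such that $x\cdot y\in I$ and $y\in I$ imply $x\in I$. An ideal $P$ is prime if $P\neq A$ and $x\wedge y\in P$ implies $x\in P$ or $y\in P$. Let $T$ be a (possibly infinite) rooted tree with root $\lambda$ and vertex set $V(T)$. A root-based path is a finite or infinite path in $T$ starting at $\lambda$ and moving away from the root (it contains at least $\lambda$); $[\lambda,\alpha]$ is the path from $\lambda$ to $\alpha$. For $\mathbf{u}\colon V(T)\to\mathbb{Z}$ write $u_\alpha$ for its value at $\alpha$ and $\mathbf{u}_p$ for the tuple of values of $\mathbf{u}$ along the path $p$; $\mathbf{0}$ is the zero function. The set $A^T$ consists of all $\mathbf{u}\colon V(T)\to\mathbb{Z}$ with finitely many non-zero values such that along every root-based path the first non-zero value (if any) is positive. With $\le_\ell$ the lexicographic order on tuples, define $$(\mathbf{u}\cdot\mathbf{v})_\alpha=\begin{cases}u_\alpha-v_\alpha&\text{if }\mathbf{u}_{[\lambda,\alpha]}>_\ell\mathbf{v}_{[\lambda,\alpha]},\\0&\text{if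 }\mathbf{u}_{[\lambda,\alpha]}\le_\ell\mathbf{v}_{[\lambda,\alpha]}.\end{cases}$$ Then $\mathbf{A}^T=\langle A^T;\cdot,\mathbf{0}\rangle$ is a commutative BCK-algebra. *)

theory Defs
  imports "Graph_Theory.Arc_Walk" "HOL-Library.Extended_Nat"
begin

section \<open>Commutative BCK-algebras\<close>

locale comm_BCK =
  fixes A :: "'a set"
    and mult :: "'a \<Rightarrow> 'a \<Rightarrow> 'a"  (infixl \<open>\<cdot>\<close> 70)
    and zero :: 'a  (\<open>\<zero>\<close>)
  assumes zero_closed: "\<zero> \<in> A"
    and mult_closed: "\<lbrakk>x \<in> A; y \<in> A\<rbrakk> \<Longrightarrow> x \<cdot> y \<in> A"
    and right_commute: "\<lbrakk>x \<in> A; y \<in> A; z \<in> A\<rbrakk> \<Longrightarrow> (x \<cdot> y) \<cdot> z = (x \<cdot> z) \<cdot> y"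
    and meet_commute: "\<lbrakk>x \<in> A; y \<in> A\<rbrakk> \<Longrightarrow> x \<cdot> (x \<cdot> y) = y \<cdot> (y \<cdot> x)"
    and mult_self: "x \<in> A \<Longrightarrow> x \<cdot> x = \<zero>"
    and mult_zero: "x \<in> A \<Longrightarrow> x \<cdot> \<zero> = x"
begin

definition meet :: "'a \<Rightarrow> 'a \<Rightarrow> 'a"  (infixl \<open>\<sqinter>\<close> 70)
  where "x \<sqinter> y = y \<cdot> (y \<cdot> x)"

definition ideal :: "'a set \<Rightarrow> bool"
  where "ideal I \<longleftrightarrow> I \<subseteq> A \<and> \<zero> \<in> I \<and> (\<forall>x\<in>A. \<forall>y\<in>A. x \<cdot> y \<in> I \<and> y \<in> I \<longrightarrow> x \<in> I)"

definition prime_ideal :: "'a set \<Rightarrow> bool"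
  where "prime_ideal P \<longleftrightarrow>
    ideal P \<and> P \<noteq> A \<and> (\<forall>x\<in>A. \<forall>y\<in>A. x \<sqinter> y \<in> P \<longrightarrow> x \<in> P \<or> y \<in> P)"

end


section \<open>Rooted trees and the algebra of a rooted tree\<close>

text \<open>
  The edges of a rooted tree are directed away from the root, so that each vertex is the end of
  exactly one directed walk from the root. The vertex set may be infinite.
\<close>

locale rooted_tree = wf_digraph T for T :: "('a, 'b) pre_digraph" +
  fixes root :: 'a
  assumes root_in_verts: "root \<in> verts T"
    and unique_awalk: "\<alpha> \<in> verts T \<Longrightarrow> \<exists>!es. awalk root es \<alpha>"
begin

text \<open>
  The pair of \<open>p\<close> and \<open>n\<close> encodes the path with vertices \<open>p i\<close> for \<open>i \<le> n\<close>; the path is infinite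
  when \<open>n = \<infinity>\<close>, and the values of \<open>p\<close> beyond \<open>n\<close> are irrelevant.
\<close>

definition root_path :: "(nat \<Rightarrow> 'a) \<Rightarrow> enat \<Rightarrow> bool"
  where "root_path p n \<longleftrightarrow> p 0 = root \<and> (\<forall>i. enat i < n \<longrightarrow> p i \<rightarrow>\<^bsub>T\<^esub> p (Suc i))"

definition path_to :: "'a \<Rightarrow> 'a list"
  where "path_to \<alpha> = awalk_verts root (THE es. awalk root es \<alpha>)"

text \<open>
  Integer functions on the vertex set are represented by functions on the whole vertex type that
  vanish outside the vertex set.
\<close>

definition tree_carrier :: "('a \<Rightarrow> int) set"
  where "tree_carrier = {u. {\<alpha>. u \<alpha> \<noteq> 0} \<subseteq> verts T \<and> finite {\<alpha>. u \<alpha> \<noteq> 0} \<and>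
    (\<forall>p n i. root_path p n \<and> enat i \<le> n \<and> (\<forall>j<i. u (p j) = 0) \<and> u (p i) \<noteq> 0 \<longrightarrow> u (p i) > 0)}"

text \<open>
  The lexicographic order is total on tuples of equal length, so the second case below is
  \<open>u \<le> v\<close> along the path to \<open>\<alpha>\<close>.
\<close>

definition tree_mult :: "('a \<Rightarrow> int) \<Rightarrow> ('a \<Rightarrow> int) \<Rightarrow> ('a \<Rightarrow> int)"
  where "tree_mult u v = (\<lambda>\<alpha>.
    if ord_class.lexordp (map v (path_to \<alpha>)) (map u (path_to \<alpha>)) then u \<alpha> - v \<alpha> else 0)"

definition path_ideal :: "(nat \<Rightarrow> 'a) \<Rightarrow> enat \<Rightarrow> ('a \<Rightarrow> int) set"
  where "path_ideal p n = {u \<in> tree_carrier. \<forall>i. enat i \<le> n \<longrightarrow> u (p i) = 0}"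

end


section \<open>The algebra of a rooted tree is a commutative BCK-algebra\<close>

definition lex_pos :: "(nat \<Rightarrow> int) \<Rightarrow> nat \<Rightarrow> bool"
  where "lex_pos a i \<longleftrightarrow> (\<exists>j\<le>i. (\<forall>k<j. a k = 0) \<and> 0 < a j)"

definition lex_sub :: "(nat \<Rightarrow> int) \<Rightarrow> (nat \<Rightarrow> int) \<Rightarrow> (nat \<Rightarrow> int)"
  where "lex_sub a b = (\<lambda>i. if lex_pos (\<lambda>k. a k - b k) i then a i - b i else 0)"

lemma lexordp_map_upt:
  fixes f g :: "nat \<Rightarrow> int"
  shows "ord_class.lexordp (map f [0..<n]) (map g [0..<n]) \<longleftrightarrow> (\<exists>j<n. (\<forall>k<j. f k = g k) \<and> f j < g j)"
proof (induction n arbitrary: f g)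
  case (Suc n)
  show ?case
    unfolding map_upt_Suc
    by (simp add: Suc.IH[of "\<lambda>i. f (Suc i)" "\<lambda>i. g (Suc i)"] Ex_less_Suc2 All_less_Suc2) auto
qed simp

lemma lex_pos_mono: "lex_pos a i \<Longrightarrow> i \<le> j \<Longrightarrow> lex_pos a j"
  unfolding lex_pos_def by (meson order_trans)

lemma lex_pos_cong: "(\<And>k. k \<le> i \<Longrightarrow> a k = b k) \<Longrightarrow> lex_pos a i \<longleftrightarrow> lex_pos b i"
  unfolding lex_pos_def by (metis less_imp_le_nat order_trans)

lemma lex_pos_total:
  assumes "\<not> lex_pos a i" "\<not> lex_pos (\<lambda>k. - a k) i" "k \<le> i"
  shows "a k = 0"
  using assms(3)
proof (induction k rule: less_induct)
  case (less k)
  have "\<forall>l<k. a l = 0" using less by auto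
  then have "\<not> 0 < a k" "\<not> 0 < - a k"
    using assms(1,2) less.prems unfolding lex_pos_def by auto
  then show ?case by simp
qed

lemma lex_pos_asym: "lex_pos a i \<Longrightarrow> \<not> lex_pos (\<lambda>k. - a k) i"
  unfolding lex_pos_def by (metis less_irrefl linorder_neqE_nat neg_0_less_iff_less less_asym neg_equal_0_iff_equal)

lemma lex_pos_add:
  assumes "lex_pos a i" "\<not> lex_pos (\<lambda>k. - b k) i"
  shows "lex_pos (\<lambda>k. a k + b k) i"
proof (cases "lex_pos b i")
  case True
  obtain j where j: "j \<le> i" "\<forall>k<j. a k = 0" "0 < a j"
    using assms(1) unfolding lex_pos_def by auto
  obtain l where l: "l \<le> i" "\<forall>k<l. b k = 0" "0 < b l"
    using True unfolding lex_pos_def by auto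
  have "min j l \<le> i" "\<forall>k<min j l. a k + b k = 0" "0 < a (min j l) + b (min j l)"
    using j l by (cases j l rule: linorder_cases; simp add: min_def)+
  then show ?thesis unfolding lex_pos_def by blast
next
  case False
  with assms have "\<And>k. k \<le> i \<Longrightarrow> b k = 0" using lex_pos_total by blast
  with assms(1) show ?thesis using lex_pos_cong[of i a "\<lambda>k. a k + b k"] by simp
qed

lemma lex_sub_pos:
  assumes "lex_pos (\<lambda>k. a k - b k) i" "k \<le> i"
  shows "lex_sub a b k = a k - b k"
proof (cases "lex_pos (\<lambda>k. a k - b k) k")
  case False
  obtain j where j: "j \<le> i" "\<forall>k<j. a k - b k = 0" "0 < a j - b j"
    using assms(1) unfolding lex_pos_def by blast
  then have "k < j" using False unfolding lex_pos_def by (meson not_le)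
  then show ?thesis using j False unfolding lex_sub_def by auto
qed (simp add: lex_sub_def)

lemma lex_sub_nonpos: "\<not> lex_pos (\<lambda>k. a k - b k) i \<Longrightarrow> k \<le> i \<Longrightarrow> lex_sub a b k = 0"
  unfolding lex_sub_def using lex_pos_mono by auto

lemma lex_sub_sub:
  assumes "\<not> lex_pos (\<lambda>k. - c k) i"
  shows "lex_sub (lex_sub a b) c i =
    (if lex_pos (\<lambda>k. a k - b k - c k) i then a i - b i - c i else 0)"
proof (cases "lex_pos (\<lambda>k. a k - b k) i")
  case True
  have "lex_pos (\<lambda>k. lex_sub a b k - c k) i \<longleftrightarrow> lex_pos (\<lambda>k. a k - b k - c k) i"
    by (rule lex_pos_cong) (simp add: lex_sub_pos[OF True])
  then show ?thesis
    using lex_sub_pos[OF True] unfolding lex_sub_def[of "lex_sub a b" c] by simp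
next
  case False
  have "lex_pos (\<lambda>k. lex_sub a b k - c k) i \<longleftrightarrow> lex_pos (\<lambda>k. - c k) i"
    by (rule lex_pos_cong) (simp add: lex_sub_nonpos[OF False])
  then have "lex_sub (lex_sub a b) c i = 0"
    using assms unfolding lex_sub_def[of "lex_sub a b" c] by simp
  moreover have "\<not> lex_pos (\<lambda>k. a k - b k - c k) i"
    using lex_pos_add[of "\<lambda>k. a k - b k - c k" i c] assms False by auto
  ultimately show ?thesis by simp
qed

lemma lex_sub_meet:
  assumes "\<not> lex_pos (\<lambda>k. - a k) i" "\<not> lex_pos (\<lambda>k. - b k) i"
  shows "lex_sub a (lex_sub a b) i = (if lex_pos (\<lambda>k. a k - b k) i then b i else a i)"
proof (cases "lex_pos (\<lambda>k. a k - b k) i")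
  case True
  have "lex_pos (\<lambda>k. a k - lex_sub a b k) i \<longleftrightarrow> lex_pos b i"
    by (rule lex_pos_cong) (simp add: lex_sub_pos[OF True])
  then show ?thesis
    using lex_sub_pos[OF True, of i] lex_pos_total[of b i i] assms True
    unfolding lex_sub_def[of a "lex_sub a b"] by auto
next
  case False
  have "lex_pos (\<lambda>k. a k - lex_sub a b k) i \<longleftrightarrow> lex_pos a i"
    by (rule lex_pos_cong) (simp add: lex_sub_nonpos[OF False])
  then show ?thesis
    using lex_sub_nonpos[OF False, of i] lex_pos_total[of a i i] assms False
    unfolding lex_sub_def[of a "lex_sub a b"] by auto
qed

context rooted_tree
begin

lemma awalk_the: "awalk root es \<alpha> \<Longrightarrow> (THE es. awalk root es \<alpha>) = es"
  using unique_awalk awalk_last_in_verts by (metis the_equality)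

lemma path_to_root_path:
  assumes "root_path p n" "enat i \<le> n"
  shows "path_to (p i) = map p [0..<Suc i]"
proof -
  have "\<exists>es. awalk root es (p i) \<and> awalk_verts root es = map p [0..<Suc i]"
    using assms(2)
  proof (induction i)
    case 0
    then show ?case
      using assms(1) root_in_verts
      by (intro exI[of _ "[]"]) (auto simp: root_path_def awalk_Nil_iff)
  next
    case (Suc i)
    then have lt: "enat i < n" by (metis Suc_ile_eq)
    with Suc obtain es where es: "awalk root es (p i)" "awalk_verts root es = map p [0..<Suc i]"
      by (metis order_less_imp_le)
    from lt assms(1) obtain e where e: "e \<in> arcs T" "tail T e = p i" "head T e = p (Suc i)"
      unfolding root_path_def by blast
    then have "awalk (p i) [e] (p (Suc i))" using tail_in_verts[OF e(1)] by (simp add: awalk_def)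
    with es(1) have w: "awalk root (es @ [e]) (p (Suc i))" by simp
    have "awalk_verts root (es @ [e]) = map p [0..<Suc (Suc i)]"
      using awalk_verts_append[OF w] es e by (simp add: awalk_verts_conv split: if_splits)
    with w show ?case by blast
  qed
  then show ?thesis unfolding path_to_def using awalk_the by metis
qed

lemma root_path_exists:
  assumes "\<alpha> \<in> verts T"
  obtains p n where "root_path p (enat n)" "p n = \<alpha>"
proof -
  have "\<exists>p. root_path p (enat (length es)) \<and> p (length es) = v" if "awalk root es v" for es v
    using that
  proof (induction es arbitrary: v rule: rev_induct)
    case Nil
    then have "v = root" by (simp add: awalk_Nil_iff)
    then show ?case by (intro exI[of _ "\<lambda>_. root"]) (simp add: root_path_def)
  next
    case (snoc e es)
    then have w: "awalk root es (tail T e)" "e \<in> arcs T" "head T e = v"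
      by (auto simp: awalk_simps)
    from snoc.IH[OF w(1)] obtain p where p:
      "root_path p (enat (length es))" "p (length es) = tail T e" by blast
    have "tail T e \<rightarrow>\<^bsub>T\<^esub> v" using w(2,3) by (auto simp: arcs_ends_conv)
    with p show ?case
      by (intro exI[of _ "p(Suc (length es) := v)"]) (auto simp: root_path_def less_Suc_eq)
  qed
  moreover obtain es where "awalk root es \<alpha>" using unique_awalk[OF assms] by (elim ex1E)
  ultimately obtain p where "root_path p (enat (length es))" "p (length es) = \<alpha>" by blast
  then show thesis by (rule that)
qed

lemma tree_mult_root_path:
  assumes "root_path p n" "enat i \<le> n"
  shows "tree_mult u v (p i) = lex_sub (\<lambda>k. u (p k)) (\<lambda>k. v (p k)) i"
proof -
  have "v (p k) = u (p k) \<longleftrightarrow> u (p k) - v (p k) = 0" for k by auto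
  then have "ord_class.lexordp (map v (path_to (p i))) (map u (path_to (p i)))
      \<longleftrightarrow> lex_pos (\<lambda>k. u (p k) - v (p k)) i"
    unfolding path_to_root_path[OF assms] lex_pos_def map_map o_def lexordp_map_upt
      less_Suc_eq_le by simp
  then show ?thesis by (simp add: tree_mult_def lex_sub_def)
qed

lemma tree_mult_seq:
  assumes "root_path p n" "enat i \<le> n"
  shows "lex_sub (\<lambda>k. tree_mult u v (p k)) c i = lex_sub (lex_sub (\<lambda>k. u (p k)) (\<lambda>k. v (p k))) c i"
    and "lex_sub c (\<lambda>k. tree_mult u v (p k)) i = lex_sub c (lex_sub (\<lambda>k. u (p k)) (\<lambda>k. v (p k))) i"
proof -
  let ?m = "\<lambda>k. tree_mult u v (p k)" and ?l = "lex_sub (\<lambda>k. u (p k)) (\<lambda>k. v (p k))"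
  have eq: "?m k = ?l k" if "k \<le> i" for k
    using tree_mult_root_path[OF assms(1)] assms(2) that
    by (meson enat_ord_simps(1) order_trans)
  have "lex_pos (\<lambda>k. ?m k - c k) i \<longleftrightarrow> lex_pos (\<lambda>k. ?l k - c k) i"
    by (rule lex_pos_cong) (simp only: eq)
  then show "lex_sub ?m c i = lex_sub ?l c i"
    by (simp only: lex_sub_def[of _ c] eq[OF order_refl])
  have "lex_pos (\<lambda>k. c k - ?m k) i \<longleftrightarrow> lex_pos (\<lambda>k. c k - ?l k) i"
    by (rule lex_pos_cong) (simp only: eq)
  then show "lex_sub c ?m i = lex_sub c ?l i"
    by (simp only: lex_sub_def[of c] eq[OF order_refl])
qed

lemma carrier_nonneg:
  assumes "u \<in> tree_carrier" "root_path p n" "enat i \<le> n"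
  shows "\<not> lex_pos (\<lambda>k. - u (p k)) i"
proof
  assume "lex_pos (\<lambda>k. - u (p k)) i"
  then obtain j where j: "j \<le> i" "\<forall>k<j. u (p k) = 0" "u (p j) < 0"
    unfolding lex_pos_def by auto
  then have "enat j \<le> n" using assms(3) by (meson enat_ord_simps(1) order_trans)
  with j assms(1,2) have "u (p j) > 0" unfolding tree_carrier_def by fastforce
  with j show False by simp
qed

lemma zero_outside: "u \<in> tree_carrier \<Longrightarrow> \<alpha> \<notin> verts T \<Longrightarrow> u \<alpha> = 0"
  unfolding tree_carrier_def by blast

lemma fun_eq_on_root_paths:
  assumes "\<And>\<alpha>. \<alpha> \<notin> verts T \<Longrightarrow> f \<alpha> = g \<alpha>"
    and "\<And>p n. root_path p (enat n) \<Longrightarrow> f (p n) = g (p n)"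
  shows "f = g"
  using assms root_path_exists by (metis ext)

lemma tree_mult_closed:
  assumes "u \<in> tree_carrier" "v \<in> tree_carrier"
  shows "tree_mult u v \<in> tree_carrier"
proof -
  have sub: "{\<alpha>. tree_mult u v \<alpha> \<noteq> 0} \<subseteq> {\<alpha>. u \<alpha> \<noteq> 0} \<union> {\<alpha>. v \<alpha> \<noteq> 0}"
    unfolding tree_mult_def by (auto split: if_splits)
  have "tree_mult u v (p i) > 0"
    if h: "root_path p n" "enat i \<le> n" "\<forall>j<i. tree_mult u v (p j) = 0" "tree_mult u v (p i) \<noteq> 0"
    for p n i
  proof -
    let ?a = "\<lambda>k. u (p k)" and ?b = "\<lambda>k. v (p k)"
    have eq: "tree_mult u v (p k) = lex_sub ?a ?b k" if "k \<le> i" for k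
      using tree_mult_root_path[OF h(1)] h(2) that by (meson enat_ord_simps(1) order_trans)
    have pos: "lex_pos (\<lambda>k. ?a k - ?b k) i"
      using h(4) eq[of i] by (auto simp: lex_sub_def split: if_splits)
    then obtain j where j: "j \<le> i" "0 < ?a j - ?b j" unfolding lex_pos_def by blast
    have "tree_mult u v (p j) = ?a j - ?b j"
      using eq[OF j(1)] lex_sub_pos[OF pos j(1)] by simp
    with j h(3) show ?thesis by (metis le_neq_implies_less less_irrefl)
  qed
  moreover have "finite {\<alpha>. tree_mult u v \<alpha> \<noteq> 0}"
    by (rule finite_subset[OF sub]) (use assms in \<open>simp add: tree_carrier_def\<close>)
  moreover have "{\<alpha>. tree_mult u v \<alpha> \<noteq> 0} \<subseteq> verts T"
    by (rule order_trans[OF sub]) (use assms in \<open>simp add: tree_carrier_def\<close>)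
  ultimately show ?thesis
    unfolding tree_carrier_def mem_Collect_eq by blast
qed

lemma comm_BCK_tree: "comm_BCK tree_carrier tree_mult (\<lambda>_. 0)"
proof
  show "(\<lambda>_. 0) \<in> tree_carrier" by (simp add: tree_carrier_def)
next
  fix u v assume "u \<in> tree_carrier" "v \<in> tree_carrier"
  then show "tree_mult u v \<in> tree_carrier" by (rule tree_mult_closed)
next
  fix u v w assume A: "u \<in> tree_carrier" "v \<in> tree_carrier" "w \<in> tree_carrier"
  show "tree_mult (tree_mult u v) w = tree_mult (tree_mult u w) v"
  proof (rule fun_eq_on_root_paths)
    fix \<alpha> assume "\<alpha> \<notin> verts T"
    then show "tree_mult (tree_mult u v) w \<alpha> = tree_mult (tree_mult u w) v \<alpha>"
      using A by (simp add: zero_outside tree_mult_closed)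
  next
    fix p n assume p: "root_path p (enat n)"
    note nn = carrier_nonneg[OF A(2) p order_refl] carrier_nonneg[OF A(3) p order_refl]
    show "tree_mult (tree_mult u v) w (p n) = tree_mult (tree_mult u w) v (p n)"
      unfolding tree_mult_root_path[OF p order_refl] tree_mult_seq(1)[OF p order_refl]
        lex_sub_sub[OF nn(1)] lex_sub_sub[OF nn(2)]
      by (simp add: algebra_simps)
  qed
next
  fix u v assume A: "u \<in> tree_carrier" "v \<in> tree_carrier"
  show "tree_mult u (tree_mult u v) = tree_mult v (tree_mult v u)"
  proof (rule fun_eq_on_root_paths)
    fix \<alpha> assume "\<alpha> \<notin> verts T"
    then show "tree_mult u (tree_mult u v) \<alpha> = tree_mult v (tree_mult v u) \<alpha>"
      using A by (simp add: zero_outside tree_mult_closed)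
  next
    fix p n assume p: "root_path p (enat n)"
    note nn = carrier_nonneg[OF A(1) p order_refl] carrier_nonneg[OF A(2) p order_refl]
    show "tree_mult u (tree_mult u v) (p n) = tree_mult v (tree_mult v u) (p n)"
      unfolding tree_mult_root_path[OF p order_refl] tree_mult_seq(2)[OF p order_refl]
        lex_sub_meet[OF nn] lex_sub_meet[OF nn(2) nn(1)]
      using lex_pos_asym[of "\<lambda>k. u (p k) - v (p k)" n]
        lex_pos_total[of "\<lambda>k. u (p k) - v (p k)" n n] by auto
  qed
next
  fix u assume "u \<in> tree_carrier"
  show "tree_mult u u = (\<lambda>_. 0)" by (auto simp: tree_mult_def)
next
  fix u assume A: "u \<in> tree_carrier"
  show "tree_mult u (\<lambda>_. 0) = u"
  proof (rule fun_eq_on_root_paths)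
    fix \<alpha> assume "\<alpha> \<notin> verts T"
    then show "tree_mult u (\<lambda>_. 0) \<alpha> = u \<alpha>" using A by (simp add: zero_outside tree_mult_def)
  next
    fix p n assume p: "root_path p (enat n)"
    show "tree_mult u (\<lambda>_. 0) (p n) = u (p n)"
      unfolding tree_mult_root_path[OF p order_refl] lex_sub_def
      using lex_pos_total[OF _ carrier_nonneg[OF A p order_refl] order_refl] by auto
  qed
qed

end

end

theory Submission
  imports Defs
begin

text \<open>
  The algebra is generated, as far as ideals are concerned, by the indicator functions of single
  vertices. Let \<open>P\<close> be an ideal and let \<open>C\<close> be the set of vertices whose indicator is not in \<open>P\<close>.
  Two facts determine \<open>P\<close> from \<open>C\<close>.

  First, an element whose support avoids \<open>C\<close> lies in \<open>P\<close> (\<open>ideal_generated_by_indicators\<close>):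
  subtracting the indicator of a topmost vertex of its support lowers the sum of the absolute
  values, so repeated subtraction of elements of \<open>P\<close> leads to zero.
  Secondly, if \<open>u \<in> P\<close> has its first non-zero value along a path at \<open>\<alpha>\<close>, then the indicators of
  \<open>\<alpha>\<close> and of all vertices below \<open>\<alpha>\<close> lie in \<open>P\<close> (\<open>ideal_contains_indicators_below\<close>), because such
  an indicator is lexicographically at most \<open>2u\<close>. Applied to an indicator \<open>u\<close>, this shows that \<open>C\<close> is
  closed under passing to ancestors; applied to arbitrary \<open>u\<close>, it shows that elements of \<open>P\<close> vanish
  on \<open>C\<close>, provided that \<open>C\<close> is a path. Hence \<open>P = I(C)\<close> as soon as \<open>C\<close> is a root-based path.

  Primality makes \<open>C\<close> a path. Two vertices neither of which is an ancestor of the other have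
  indicators with meet zero (\<open>meet_indicators_incomparable\<close>), so they are not both in \<open>C\<close>; and
  \<open>C\<close> is non-empty since otherwise \<open>P\<close> would be the whole algebra.

  Conversely, restriction to a path maps into a lexicographically ordered chain, where the meet of
  two positive elements is their minimum and so is positive. Hence every \<open>I(p)\<close> is prime.
\<close>

context rooted_tree
begin

interpretation bck: comm_BCK tree_carrier tree_mult "\<lambda>_. 0"
  by (rule comm_BCK_tree)

section \<open>Root-based paths\<close>

lemma root_path_le: "root_path p n \<Longrightarrow> m \<le> n \<Longrightarrow> root_path p m"
  unfolding root_path_def by (meson less_le_trans)

text \<open>
  A vertex determines its depth and the path leading to it, because \<open>path_to\<close> lists that path.
\<close>

lemma root_path_unique:
  assumes "root_path p n" "enat i \<le> n" "root_path q m" "enat j \<le> m" "p i = q j"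
  shows "i = j" and "k \<le> i \<Longrightarrow> p k = q k"
proof -
  have eq: "map p [0..<Suc i] = map q [0..<Suc j]"
    using path_to_root_path[OF assms(1,2)] path_to_root_path[OF assms(3,4)] assms(5) by simp
  then have "length (map p [0..<Suc i]) = length (map q [0..<Suc j])" by (rule arg_cong)
  then show ij: "i = j" by simp
  show "p k = q k" if "k \<le> i"
  proof -
    have "map p [0..<Suc i] ! k = map q [0..<Suc j] ! k" using eq by simp
    then show ?thesis using that ij by (simp del: upt_Suc)
  qed
qed

lemma root_path_in_verts:
  assumes "root_path p n" "enat i \<le> n"
  shows "p i \<in> verts T"
proof (cases i)
  case 0
  then show ?thesis using assms(1) root_in_verts by (simp add: root_path_def)
next
  case (Suc k)
  then have "enat k < n" using assms(2) by (metis Suc_ile_eq)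
  then have "p k \<rightarrow>\<^bsub>T\<^esub> p i" using assms(1) Suc unfolding root_path_def by blast
  then show ?thesis by (rule adj_in_verts(2))
qed

lemma carrier_first_nonzero_pos:
  assumes "u \<in> tree_carrier" "root_path p n" "enat i \<le> n" "\<forall>j<i. u (p j) = 0" "u (p i) \<noteq> 0"
  shows "u (p i) > 0"
  using assms unfolding tree_carrier_def by blast

lemma first_nonzero_on_path:
  assumes "u \<in> tree_carrier" "root_path p n" "enat i \<le> n" "u (p i) \<noteq> 0"
  obtains j where "j \<le> i" "\<forall>k<j. u (p k) = 0" "u (p j) > 0"
proof -
  define j where "j = (LEAST j. u (p j) \<noteq> 0)"
  have j: "u (p j) \<noteq> 0" "j \<le> i" "\<forall>k<j. u (p k) = 0"
    unfolding j_def using LeastI[of "\<lambda>j. u (p j) \<noteq> 0"] assms(4) not_less_Least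
    by (auto intro: Least_le)
  moreover have "enat j \<le> n" using j(2) assms(3) by (meson enat_ord_simps(1) order_trans)
  ultimately show thesis using that carrier_first_nonzero_pos[OF assms(1,2)] by blast
qed

lemma meet_root_path:
  assumes "u \<in> tree_carrier" "v \<in> tree_carrier" "root_path p n" "enat i \<le> n"
  shows "bck.meet u v (p i) = (if lex_pos (\<lambda>k. v (p k) - u (p k)) i then u (p i) else v (p i))"
  unfolding bck.meet_def tree_mult_root_path[OF assms(3,4)] tree_mult_seq(2)[OF assms(3,4)]
  by (rule lex_sub_meet[OF carrier_nonneg[OF assms(2-4)] carrier_nonneg[OF assms(1,3,4)]])

lemma meet_commute_tree:
  "u \<in> tree_carrier \<Longrightarrow> v \<in> tree_carrier \<Longrightarrow> bck.meet u v = bck.meet v u"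
  unfolding bck.meet_def by (rule bck.meet_commute)

lemma meet_zero_on_path:
  assumes "u \<in> tree_carrier" "v \<in> tree_carrier" "root_path p n" "enat i \<le> n"
    and "\<And>k. k \<le> i \<Longrightarrow> u (p k) = 0"
  shows "bck.meet u v (p i) = 0"
proof -
  have "lex_pos (\<lambda>k. v (p k) - u (p k)) i \<longleftrightarrow> lex_pos (\<lambda>k. v (p k)) i"
    by (rule lex_pos_cong) (simp add: assms(5))
  then show ?thesis
    unfolding meet_root_path[OF assms(1-4)]
    using assms(5) lex_pos_total[OF _ carrier_nonneg[OF assms(2-4)] order_refl] by auto
qed


section \<open>Path ideals are prime\<close>

lemma path_ideal_is_ideal:
  assumes p: "root_path p n"
  shows "bck.ideal (path_ideal p n)"
  unfolding bck.ideal_def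
proof (intro conjI ballI impI)
  show "path_ideal p n \<subseteq> tree_carrier" "(\<lambda>_. 0) \<in> path_ideal p n"
    using bck.zero_closed by (auto simp: path_ideal_def)
  fix u v assume u: "u \<in> tree_carrier" and v: "v \<in> tree_carrier"
    and uv: "tree_mult u v \<in> path_ideal p n \<and> v \<in> path_ideal p n"
  have "u (p i) = 0" if i: "enat i \<le> n" for i
  proof -
    have v0: "v (p k) = 0" if "k \<le> i" for k
      using uv order_trans[OF _ i, of "enat k"] that by (simp add: path_ideal_def)
    have "lex_pos (\<lambda>k. u (p k) - v (p k)) i \<longleftrightarrow> lex_pos (\<lambda>k. u (p k)) i"
      by (rule lex_pos_cong) (simp add: v0)
    moreover have "lex_sub (\<lambda>k. u (p k)) (\<lambda>k. v (p k)) i = 0"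
      using uv i tree_mult_root_path[OF p i, of u v] by (simp add: path_ideal_def)
    ultimately show ?thesis
      using v0[of i] lex_pos_total[OF _ carrier_nonneg[OF u p i] order_refl]
      by (auto simp: lex_sub_def split: if_splits)
  qed
  then show "u \<in> path_ideal p n" using u by (simp add: path_ideal_def)
qed

text \<open>
  Along \<open>p\<close> the meet is the lexicographic minimum. If \<open>u\<close> and \<open>v\<close> have their first non-zero values
  at \<open>i \<le> j\<close>, then this minimum is still non-zero at \<open>j\<close>.
\<close>

lemma meet_nonzero_at_later_first_nonzero:
  assumes "u \<in> tree_carrier" "v \<in> tree_carrier" "root_path p n" "enat j \<le> n" "i \<le> j"
    and "\<forall>k<i. u (p k) = 0" "0 < u (p i)" "\<forall>k<j. v (p k) = 0" "0 < v (p j)"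
  shows "bck.meet u v (p j) \<noteq> 0"
proof (cases "i = j")
  case True
  then show ?thesis using assms(7,9) by (simp add: meet_root_path[OF assms(1-4)])
next
  case False
  then have "lex_pos (\<lambda>k. u (p k) - v (p k)) j"
    using assms(5-8) unfolding lex_pos_def by (intro exI[of _ i]) auto
  then show ?thesis
    using assms(9) meet_root_path[OF assms(2,1,3,4)] meet_commute_tree[OF assms(1,2)] by simp
qed

abbreviation indicator :: "'a \<Rightarrow> 'a \<Rightarrow> int"
  where "indicator \<alpha> \<equiv> \<lambda>\<beta>. if \<beta> = \<alpha> then 1 else 0"

lemma indicator_in_carrier: "\<alpha> \<in> verts T \<Longrightarrow> indicator \<alpha> \<in> tree_carrier"
  unfolding tree_carrier_def by (auto split: if_splits)

lemma path_ideal_is_prime: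
  assumes p: "root_path p n"
  shows "bck.prime_ideal (path_ideal p n)"
  unfolding bck.prime_ideal_def
proof (intro conjI ballI impI)
  show "bck.ideal (path_ideal p n)" using p by (rule path_ideal_is_ideal)
  have "p 0 = root" using p by (simp add: root_path_def)
  then have "indicator root \<notin> path_ideal p n"
    by (auto simp: path_ideal_def zero_enat_def[symmetric] intro!: exI[of _ 0])
  then show "path_ideal p n \<noteq> tree_carrier" using indicator_in_carrier[OF root_in_verts] by blast
  fix u v assume u: "u \<in> tree_carrier" and v: "v \<in> tree_carrier"
    and uv: "bck.meet u v \<in> path_ideal p n"
  show "u \<in> path_ideal p n \<or> v \<in> path_ideal p n"
  proof (rule ccontr)
    assume "\<not> ?thesis"
    then obtain i' j' where ij': "enat i' \<le> n" "u (p i') \<noteq> 0" "enat j' \<le> n" "v (p j') \<noteq> 0"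
      using u v by (auto simp: path_ideal_def)
    obtain i where i: "i \<le> i'" "\<forall>k<i. u (p k) = 0" "u (p i) > 0"
      using first_nonzero_on_path[OF u p ij'(1,2)] .
    obtain j where j: "j \<le> j'" "\<forall>k<j. v (p k) = 0" "v (p j) > 0"
      using first_nonzero_on_path[OF v p ij'(3,4)] .
    have le: "enat i \<le> n" "enat j \<le> n"
      using i(1) j(1) ij'(1,3) by (meson enat_ord_simps(1) order_trans)+
    have "bck.meet u v (p (max i j)) \<noteq> 0"
    proof (cases "i \<le> j")
      case True
      then show ?thesis
        using meet_nonzero_at_later_first_nonzero[OF u v p le(2) True i(2,3) j(2,3)]
        by (simp add: max_def)
    next
      case False
      then have "j \<le> i" by simp
      then show ?thesis
        using meet_nonzero_at_later_first_nonzero[OF v u p le(1) \<open>j \<le> i\<close> j(2,3) i(2,3)]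
          meet_commute_tree[OF u v] by (simp add: max_def)
    qed
    moreover have "enat (max i j) \<le> n" using le by (simp add: max_def)
    ultimately show False using uv by (simp add: path_ideal_def)
  qed
qed


section \<open>Ideals and indicator functions\<close>

lemma ideal_cancel:
  "bck.ideal P \<Longrightarrow> u \<in> tree_carrier \<Longrightarrow> v \<in> P \<Longrightarrow> tree_mult u v \<in> P \<Longrightarrow> u \<in> P"
  unfolding bck.ideal_def by blast

text \<open>
  Subtracting the indicator of a topmost vertex \<open>\<alpha>\<close> of the support brings the positive value at \<open>\<alpha>\<close>
  closer to zero and keeps or annihilates every other value, hence the induction on the sum of
  the absolute values.
\<close>

lemma ideal_generated_by_indicators:
  assumes P: "bck.ideal P"
    and "u \<in> tree_carrier" "\<And>\<alpha>. u \<alpha> \<noteq> 0 \<Longrightarrow> indicator \<alpha> \<in> P"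
  shows "u \<in> P"
  using assms(2,3)
proof (induction "\<Sum>\<beta> | u \<beta> \<noteq> 0. nat \<bar>u \<beta>\<bar>" arbitrary: u rule: less_induct)
  case less
  note u = less.prems(1)
  show ?case
  proof (cases "\<exists>\<beta>. u \<beta> \<noteq> 0")
    case False
    then have "u = (\<lambda>_. 0)" by auto
    then show ?thesis using P by (simp add: bck.ideal_def)
  next
    case True
    then obtain \<beta> where \<beta>: "u \<beta> \<noteq> 0" by blast
    then have "\<beta> \<in> verts T" using u zero_outside by blast
    then obtain q m where q: "root_path q (enat m)" "q m = \<beta>" by (rule root_path_exists)
    then obtain i where i: "u (q i) > 0"
      using first_nonzero_on_path[OF u q(1) order_refl] \<beta> by blast
    define \<alpha> where "\<alpha> = q i"
    have pos: "u \<alpha> > 0" using i by (simp add: \<alpha>_def)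
    then have ind: "indicator \<alpha> \<in> P" using less.prems(2) by simp
    define v where "v = tree_mult u (indicator \<alpha>)"
    have v: "v \<in> tree_carrier"
      unfolding v_def using u ind P by (auto simp: bck.ideal_def intro: tree_mult_closed)
    have other: "v \<gamma> = u \<gamma> \<or> v \<gamma> = 0" if "\<gamma> \<noteq> \<alpha>" for \<gamma>
      using that by (simp add: v_def tree_mult_def)
    have at: "v \<alpha> = u \<alpha> - 1 \<or> v \<alpha> = 0"
      by (simp add: v_def tree_mult_def)
    have supp: "{\<gamma>. v \<gamma> \<noteq> 0} \<subseteq> {\<gamma>. u \<gamma> \<noteq> 0}"
      using other pos by force
    have fin: "finite {\<gamma>. u \<gamma> \<noteq> 0}" using u by (simp add: tree_carrier_def)
    have "(\<Sum>\<gamma> | v \<gamma> \<noteq> 0. nat \<bar>v \<gamma>\<bar>) = (\<Sum>\<gamma> | u \<gamma> \<noteq> 0. nat \<bar>v \<gamma>\<bar>)"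
      by (rule sum.mono_neutral_left[OF fin supp]) auto
    also have "\<dots> < (\<Sum>\<gamma> | u \<gamma> \<noteq> 0. nat \<bar>u \<gamma>\<bar>)"
    proof (rule sum_strict_mono_ex1[OF fin])
      have "nat \<bar>v \<gamma>\<bar> \<le> nat \<bar>u \<gamma>\<bar>" for \<gamma>
        using other[of \<gamma>] at pos by (cases "\<gamma> = \<alpha>") auto
      then show "\<forall>\<gamma>\<in>{\<gamma>. u \<gamma> \<noteq> 0}. nat \<bar>v \<gamma>\<bar> \<le> nat \<bar>u \<gamma>\<bar>" by blast
      show "\<exists>\<gamma>\<in>{\<gamma>. u \<gamma> \<noteq> 0}. nat \<bar>v \<gamma>\<bar> < nat \<bar>u \<gamma>\<bar>"
        using at pos by (intro bexI[of _ \<alpha>]) auto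
    qed
    finally have "v \<in> P"
      using less.hyps v supp less.prems(2) by blast
    then show ?thesis using ideal_cancel[OF P u ind] by (simp add: v_def)
  qed
qed

text \<open>
  Let \<open>x\<close> be the difference of the indicator of \<open>q j\<close> and \<open>u\<close> in the algebra. Then \<open>x\<close> may be
  non-zero below \<open>q i\<close>, namely if \<open>j = i\<close> and \<open>u\<close> has the value one at \<open>q i\<close> and a negative value
  below it. But \<open>x\<close> vanishes at \<open>q i\<close> and above, and \<open>u\<close> is positive at \<open>q i\<close>, so subtracting \<open>u\<close>
  once more gives zero.
\<close>

lemma ideal_contains_indicators_below:
  assumes P: "bck.ideal P" and u: "u \<in> P"
    and q: "root_path q m" and j: "enat j \<le> m" and ij: "i \<le> j"
    and zero: "\<forall>k<i. u (q k) = 0" and pos: "u (q i) > 0"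
  shows "indicator (q j) \<in> P"
proof -
  let ?e = "indicator (q j)"
  have uA: "u \<in> tree_carrier" using P u by (auto simp: bck.ideal_def)
  have e: "?e \<in> tree_carrier" using indicator_in_carrier root_path_in_verts[OF q j] by blast
  define x where "x = tree_mult ?e u"
  have x: "x \<in> tree_carrier" unfolding x_def using e uA by (rule tree_mult_closed)
  have "tree_mult x u = (\<lambda>_. 0)"
  proof (rule fun_eq_on_root_paths)
    fix \<alpha> assume "\<alpha> \<notin> verts T"
    then show "tree_mult x u \<alpha> = 0" using zero_outside[OF tree_mult_closed[OF x uA]] by simp
  next
    fix s l assume s: "root_path s (enat l)"
    have xs: "x (s k) = lex_sub (\<lambda>k. ?e (s k)) (\<lambda>k. u (s k)) k" if "k \<le> l" for k
      unfolding x_def using that by (intro tree_mult_root_path[OF s]) simp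
    have "\<not> lex_pos (\<lambda>k. x (s k) - u (s k)) l"
    proof (cases "\<exists>k\<le>l. s k = q j")
      case False
      have "x (s k) = 0" if k: "k \<le> l" for k
      proof -
        have "lex_pos (\<lambda>k. ?e (s k) - u (s k)) k \<longleftrightarrow> lex_pos (\<lambda>k. - u (s k)) k"
          by (rule lex_pos_cong) (use False k in auto)
        then show ?thesis
          using xs[OF k] carrier_nonneg[OF uA s, of k] k by (simp add: lex_sub_def)
      qed
      then have "lex_pos (\<lambda>k. x (s k) - u (s k)) l \<longleftrightarrow> lex_pos (\<lambda>k. - u (s k)) l"
        by (intro lex_pos_cong) simp
      then show ?thesis using carrier_nonneg[OF uA s, of l] by simp
    next
      case True
      then obtain k where "k \<le> l" "s k = q j" by blast
      then have jl: "j \<le> l" and sq: "\<And>k. k \<le> j \<Longrightarrow> s k = q k"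
        using root_path_unique[OF s _ q j, of k] by auto
      have u0: "u (s k) = 0" if "k < i" for k using zero that ij sq by simp
      have ui: "u (s i) > 0" using pos ij sq by simp
      have e0: "?e (s k) = 0" if "k < i" for k
        using root_path_unique(1)[OF s _ q j, of k] that ij jl by auto
      have "\<not> lex_pos (\<lambda>k. ?e (s k) - u (s k)) i"
      proof
        assume "lex_pos (\<lambda>k. ?e (s k) - u (s k)) i"
        then obtain a where a: "a \<le> i" "0 < ?e (s a) - u (s a)" unfolding lex_pos_def by blast
        then show False
          using u0[of a] e0[of a] ui by (cases "a = i") (auto split: if_splits)
      qed
      then have "lex_sub (\<lambda>k. ?e (s k)) (\<lambda>k. u (s k)) k = 0" if "k \<le> i" for k
        using that by (rule lex_sub_nonpos)
      then have x0: "x (s k) = 0" if "k \<le> i" for k using that xs[of k] ij jl by simp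
      have "lex_pos (\<lambda>k. - (x (s k) - u (s k))) l"
        unfolding lex_pos_def using x0 u0 ui ij jl by (intro exI[of _ i]) auto
      then show ?thesis using lex_pos_asym[of "\<lambda>k. x (s k) - u (s k)" l] by blast
    qed
    then show "tree_mult x u (s l) = 0"
      by (simp add: tree_mult_root_path[OF s order_refl] lex_sub_def)
  qed
  then have "tree_mult x u \<in> P" using P by (simp add: bck.ideal_def)
  then have "x \<in> P" using ideal_cancel[OF P x u] by blast
  then show ?thesis using ideal_cancel[OF P e u] by (simp add: x_def)
qed

text \<open>
  A root-based path through \<open>r m\<close> follows \<open>r\<close> up to there, so it misses \<open>q n\<close>. Thus along every
  root-based path one of the two indicators vanishes, and with it the meet.
\<close>

lemma meet_indicators_incomparable:
  assumes q: "root_path q (enat n)" and r: "root_path r (enat m)" and nm: "n \<le> m"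
    and neq: "q n \<noteq> r n"
  shows "bck.meet (indicator (q n)) (indicator (r m)) = (\<lambda>_. 0)"
proof -
  have A: "indicator (q n) \<in> tree_carrier" "indicator (r m) \<in> tree_carrier"
    using indicator_in_carrier root_path_in_verts[OF q] root_path_in_verts[OF r] by auto
  show ?thesis
  proof (rule fun_eq_on_root_paths)
    fix \<alpha> assume "\<alpha> \<notin> verts T"
    then show "bck.meet (indicator (q n)) (indicator (r m)) \<alpha> = 0"
      using zero_outside A by (simp add: bck.meet_def tree_mult_closed)
  next
    fix s l assume s: "root_path s (enat l)"
    show "bck.meet (indicator (q n)) (indicator (r m)) (s l) = 0"
    proof (cases "\<exists>k\<le>l. s k = r m")
      case True
      then obtain k where k: "k \<le> l" "s k = r m" by blast
      then have sr: "\<And>k. k \<le> m \<Longrightarrow> s k = r k"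
        using root_path_unique[OF s _ r order_refl, of k] by auto
      have "s k \<noteq> q n" if "k \<le> l" for k
        using root_path_unique(1)[OF s _ q order_refl, of k] that sr[OF nm] neq by auto
      then show ?thesis
        by (intro meet_zero_on_path[OF A s order_refl]) simp
    next
      case False
      then have "bck.meet (indicator (r m)) (indicator (q n)) (s l) = 0"
        by (intro meet_zero_on_path[OF A(2,1) s order_refl]) auto
      then show ?thesis using meet_commute_tree[OF A] by simp
    qed
  qed
qed


section \<open>Prime ideals are path ideals\<close>

text \<open>
  The path is read off level by level: the chain condition leaves at most one vertex of \<open>C\<close> at each
  depth, and closure under ancestors makes the set \<open>D\<close> of occurring depths an initial segment. Its
  supremum is the length of the path, infinite exactly if the depths are unbounded.
\<close>

lemma root_path_of_chain:
  assumes chain: "\<And>q n r m. \<lbrakk>root_path q (enat n); root_path r (enat m); n \<le> m; q n \<in> C; r m \<in> C\<rbrakk>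
      \<Longrightarrow> q n = r n"
    and closed: "\<And>q m i. \<lbrakk>root_path q (enat m); q m \<in> C; i \<le> m\<rbrakk> \<Longrightarrow> q i \<in> C"
    and "C \<subseteq> verts T" "C \<noteq> {}"
  obtains p n where "root_path p n" "C = p ` {i. enat i \<le> n}"
proof -
  define D where "D = {i. \<exists>q. root_path q (enat i) \<and> q i \<in> C}"
  define p where "p i = (SOME q. root_path q (enat i) \<and> q i \<in> C) i" for i
  define n where "n = Sup (enat ` D)"
  have p_eq: "p i = q i" if "root_path q (enat m)" "q m \<in> C" "i \<le> m" for q m i
  proof -
    define r where "r = (SOME q. root_path q (enat i) \<and> q i \<in> C)"
    have q: "root_path q (enat i)" "q i \<in> C"
      using root_path_le[OF that(1)] closed[OF that] that(3) by auto
    then have "root_path r (enat i) \<and> r i \<in> C"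
      unfolding r_def using someI[of "\<lambda>q. root_path q (enat i) \<and> q i \<in> C" q] by simp
    then have "r i = q i" using chain[of r i q i] q by blast
    then show ?thesis by (simp add: p_def r_def)
  qed
  have vertex: "\<exists>q m. root_path q (enat m) \<and> q m = \<alpha>" if "\<alpha> \<in> C" for \<alpha>
    using that assms(3) root_path_exists by blast
  have D0: "0 \<in> D"
  proof -
    obtain \<alpha> where "\<alpha> \<in> C" using assms(4) by blast
    then obtain q m where "root_path q (enat m)" "q m \<in> C" using vertex by blast
    then have "root_path q (enat 0)" "q 0 \<in> C" using root_path_le closed by auto
    then show ?thesis unfolding D_def by blast
  qed
  have Suc_D: "\<exists>d\<in>D. Suc i \<le> d" if "enat i < n" for i
    using that unfolding n_def less_Sup_iff by (auto simp: Suc_le_eq)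
  have D_below: "\<exists>d\<in>D. i \<le> d" if "enat i \<le> n" for i
  proof (cases i)
    case 0 then show ?thesis using D0 by blast
  next
    case (Suc k)
    then show ?thesis using Suc_D that by (metis Suc_ile_eq)
  qed
  have "root_path p n"
    unfolding root_path_def
  proof (intro conjI allI impI)
    show "p 0 = root"
    proof -
      obtain q where q: "root_path q (enat 0)" "q 0 \<in> C" using D0 unfolding D_def by blast
      then show ?thesis using p_eq[OF q order_refl] by (metis root_path_def)
    qed
    fix i assume "enat i < n"
    then obtain d q where "Suc i \<le> d" and q: "root_path q (enat d)" "q d \<in> C"
      using Suc_D unfolding D_def by blast
    then have "q i \<rightarrow>\<^bsub>T\<^esub> q (Suc i)" "p i = q i" "p (Suc i) = q (Suc i)"
      using p_eq[OF q] by (auto simp: root_path_def)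
    then show "p i \<rightarrow>\<^bsub>T\<^esub> p (Suc i)" by simp
  qed
  moreover have "C = p ` {i. enat i \<le> n}"
  proof (intro equalityI subsetI)
    fix \<alpha> assume "\<alpha> \<in> C"
    then obtain q m where q: "root_path q (enat m)" "q m = \<alpha>" using vertex by blast
    then have "\<alpha> = p m" "m \<in> D"
      using p_eq[OF q(1), of m] \<open>\<alpha> \<in> C\<close> unfolding D_def by auto
    then show "\<alpha> \<in> p ` {i. enat i \<le> n}" unfolding n_def by (auto intro: Sup_upper)
  next
    fix \<alpha> assume "\<alpha> \<in> p ` {i. enat i \<le> n}"
    then obtain i where i: "\<alpha> = p i" "enat i \<le> n" by blast
    then obtain d q where "i \<le> d" "root_path q (enat d)" "q d \<in> C"
      using D_below unfolding D_def by blast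
    then show "\<alpha> \<in> C" using p_eq closed i(1) by metis
  qed
  ultimately show thesis by (rule that)
qed

lemma prime_ideal_is_path_ideal:
  assumes prime: "bck.prime_ideal P"
  obtains p n where "root_path p n" "P = path_ideal p n"
proof -
  have P: "bck.ideal P" and proper: "P \<noteq> tree_carrier"
    using prime by (auto simp: bck.prime_ideal_def)
  then have sub: "P \<subseteq> tree_carrier" and zero: "(\<lambda>_. 0) \<in> P" by (auto simp: bck.ideal_def)
  define C where "C = {\<alpha> \<in> verts T. indicator \<alpha> \<notin> P}"
  obtain p n where p: "root_path p n" and C: "C = p ` {i. enat i \<le> n}"
  proof (rule root_path_of_chain[of C])
    fix q n r m
    assume h: "root_path q (enat n)" "root_path r (enat m)" "n \<le> m" "q n \<in> C" "r m \<in> C"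
    show "q n = r n"
    proof (rule ccontr)
      assume "q n \<noteq> r n"
      then have "bck.meet (indicator (q n)) (indicator (r m)) \<in> P"
        using meet_indicators_incomparable[OF h(1-3)] zero by simp
      then show False
        using h(4,5) prime indicator_in_carrier unfolding C_def bck.prime_ideal_def by blast
    qed
  next
    fix q m i assume h: "root_path q (enat m)" "q m \<in> C" "i \<le> m"
    show "q i \<in> C"
    proof (rule ccontr)
      assume "q i \<notin> C"
      moreover have "q i \<in> verts T" using root_path_in_verts[OF h(1)] h(3) by simp
      ultimately have "indicator (q i) \<in> P" by (simp add: C_def)
      moreover have "\<forall>k<i. q k \<noteq> q i"
        using root_path_unique(1)[OF h(1) _ h(1), of _ i] h(3)
        by (metis enat_ord_simps(1) less_imp_le_nat less_irrefl order_trans)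
      ultimately have "indicator (q m) \<in> P"
        using ideal_contains_indicators_below[OF P _ h(1) order_refl h(3), of "indicator (q i)"]
        by auto
      then show False using h(2) by (simp add: C_def)
    qed
  next
    show "C \<subseteq> verts T" by (auto simp: C_def)
    show "C \<noteq> {}"
    proof
      assume "C = {}"
      then have "u \<in> P" if "u \<in> tree_carrier" for u
        using ideal_generated_by_indicators[OF P that] zero_outside[OF that]
        by (auto simp: C_def)
      then show False using sub proper by blast
    qed
  qed
  have "P = path_ideal p n"
  proof (intro equalityI subsetI)
    fix u assume u: "u \<in> P"
    then have uA: "u \<in> tree_carrier" using sub by blast
    have "u (p i) = 0" if i: "enat i \<le> n" for i
    proof (rule ccontr)
      assume "u (p i) \<noteq> 0"
      then obtain j where j: "j \<le> i" "\<forall>k<j. u (p k) = 0" "u (p j) > 0"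
        using first_nonzero_on_path[OF uA p i] by blast
      then have "indicator (p i) \<in> P" using ideal_contains_indicators_below[OF P u p i] by blast
      then show False using C i by (auto simp: C_def)
    qed
    then show "u \<in> path_ideal p n" using uA by (simp add: path_ideal_def)
  next
    fix u assume "u \<in> path_ideal p n"
    then have uA: "u \<in> tree_carrier" and "\<And>\<alpha>. \<alpha> \<in> C \<Longrightarrow> u \<alpha> = 0"
      by (auto simp: path_ideal_def C)
    then show "u \<in> P"
      using ideal_generated_by_indicators[OF P uA] zero_outside[OF uA] unfolding C_def by blast
  qed
  then show thesis using p that by blast
qed

lemma prime_ideal_iff_path_ideal:
  "bck.prime_ideal P \<longleftrightarrow> (\<exists>p n. root_path p n \<and> P = path_ideal p n)"
  using path_ideal_is_prime prime_ideal_is_path_ideal by metis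

end

theorem theorem3p11:
  fixes T :: "('a, 'b) pre_digraph" and root :: 'a and P :: "('a \<Rightarrow> int) set"
  assumes "rooted_tree T root"
  shows "comm_BCK.prime_ideal (rooted_tree.tree_carrier T root) (rooted_tree.tree_mult T root) (\<lambda>_. 0) P
    \<longleftrightarrow> (\<exists>p n. rooted_tree.root_path T root p n \<and> P = rooted_tree.path_ideal T root p n)"
  using assms by (rule rooted_tree.prime_ideal_iff_path_ideal)

end
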